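(* There is an absolute constant $K$ such that for every $n\ge 2$ and every finite collection $R$ of transmissions on the linear array with nodes $0,1,\dots,n-1$, with congestion $c=c(R)$, the entire collection $R$ can be scheduled using at most $K(c+\log_2 n)$ wavelengths (i.e. $O(c+\log n)$ wavelengths). This holds both for the splittable and for the non-splittable version of the problem.
   Context: Stationary light-trail scheduling problem. The network is a linear array of nodes $0,1,\dots,n-1$; link $l$ ($0\le l\le n-2$) joins nodes $l$ and $l+1$. A transmission $[i,j]$ with $0\le i<j\le n-1$ has a bandwidth requirement (height) in $(0,1]$, expressed as a fraction of the capacity $1$ of a wavelength; it uses (crosses) the links $i,\dots,j-1$. On each wavelength, every node has a shutter which is ON or OFF; the shutters at nodes $0$ and $n-1$ are always OFF. A light-trail is a segment $[u,v]$ of a wavelength between two consecutive OFF shutters. A transmission $[i,j]$ can be assigned to a light-trail $[u,v]$ only if $u\le i<j\le v$, and the total bandwidth of the transmissions assigned to any single light-trail must be at most $1$. To schedule a collection of transmissions using $w$ wavelengths means to choose shutter settings on $w$ wavelengths and assign every transmission to light-trails so that these constraints hold. In the non-splittable version each transmission is assigned to a single light-trail; in the splittable version a transmission may be split into several transmissions with the same endpoints whose bandwidths sum to the original one, and the parts may be assigned to different light-trails. Congestion: for a collection $S$ of transmissions, $c_l(S)$ is the total bandwidth of those transmissions of $S$ that cross link $l$, and $c(S)=\max_l c_l(S)$. *)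

theory Defs
  imports Complex_Main
begin

datatype transmission = Transmission (src: nat) (dst: nat) (height: real)

definition valid_transmission :: "nat \<Rightarrow> transmission \<Rightarrow> bool" where
  "valid_transmission n t \<longleftrightarrow>
     src t < dst t \<and> dst t \<le> n - 1 \<and> 0 < height t \<and> height t \<le> 1"

text \<open>Link \<open>l\<close> joins nodes \<open>l\<close> and \<open>l + 1\<close>.\<close>

definition crosses :: "transmission \<Rightarrow> nat \<Rightarrow> bool" where
  "crosses t l \<longleftrightarrow> src t \<le> l \<and> l < dst t"

text \<open>A finite collection of transmissions, possibly with repetitions, is a list. The order of the
  list plays no role; its positions serve to tell equal transmissions apart.\<close>

definition link_congestion :: "transmission list \<Rightarrow> nat \<Rightarrow> real" where
  "link_congestion R l = (\<Sum>t\<leftarrow>filter (\<lambda>t. crosses t l) R. height t)"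

definition congestion :: "nat \<Rightarrow> transmission list \<Rightarrow> real" where
  "congestion n R = Max (link_congestion R ` {0..n - 2})"

text \<open>The shutter setting of a wavelength is given by the set of nodes whose shutter is OFF.\<close>

definition valid_shutters :: "nat \<Rightarrow> nat set \<Rightarrow> bool" where
  "valid_shutters n off \<longleftrightarrow> off \<subseteq> {0..n - 1} \<and> 0 \<in> off \<and> n - 1 \<in> off"

text \<open>The light-trail \<open>[u, v]\<close> of wavelength \<open>k\<close> is the triple \<open>(k, u, v)\<close>.\<close>

type_synonym light_trail = "nat \<times> nat \<times> nat"

definition light_trails :: "nat \<Rightarrow> (nat \<Rightarrow> nat set) \<Rightarrow> light_trail set" where
  "light_trails w off =
     {(k, u, v). k < w \<and> u < v \<and> u \<in> off k \<and> v \<in> off k \<and> off k \<inter> {u<..<v} = {}}"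

definition fits :: "transmission \<Rightarrow> light_trail \<Rightarrow> bool" where
  "fits t L = (case L of (k, u, v) \<Rightarrow> u \<le> src t \<and> dst t \<le> v)"

definition is_schedule ::
  "nat \<Rightarrow> nat \<Rightarrow> transmission list \<Rightarrow> (nat \<Rightarrow> nat set) \<Rightarrow> (nat \<Rightarrow> light_trail) \<Rightarrow> bool" where
  "is_schedule n w R off A \<longleftrightarrow>
     (\<forall>k<w. valid_shutters n (off k)) \<and>
     (\<forall>i<length R. A i \<in> light_trails w off \<and> fits (R ! i) (A i)) \<and>
     (\<forall>L\<in>light_trails w off. (\<Sum>i | i < length R \<and> A i = L. height (R ! i)) \<le> 1)"

definition schedulable :: "nat \<Rightarrow> nat \<Rightarrow> transmission list \<Rightarrow> bool" where
  "schedulable n w R \<longleftrightarrow> (\<exists>off A. is_schedule n w R off A)"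

definition splits_into :: "transmission \<Rightarrow> transmission list \<Rightarrow> bool" where
  "splits_into t P \<longleftrightarrow>
     (\<forall>s\<in>set P. src s = src t \<and> dst s = dst t \<and> 0 < height s) \<and>
     (\<Sum>s\<leftarrow>P. height s) = height t"

definition splittably_schedulable :: "nat \<Rightarrow> nat \<Rightarrow> transmission list \<Rightarrow> bool" where
  "splittably_schedulable n w R \<longleftrightarrow>
     (\<exists>Ps. list_all2 splits_into R Ps \<and> schedulable n w (concat Ps))"

end

theory Submission
  imports Defs "HOL-Library.Disjoint_Sets"
begin

text \<open>Transmissions are grouped into light-trails of total height at most \<open>1\<close> so that every link
  lies under \<open>O(c + log n)\<close> of the intervals spanned by the groups; interval graphs being perfect,
  these intervals then fit on as many wavelengths. Transmissions higher than \<open>1/2\<close> form singleton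
  groups. The others are organised in a binary tree over the nodes, a transmission being stored at
  the first midpoint link that it crosses, so that a link meets one midpoint per level. For
  the transmissions over one midpoint, groups of total height at least \<open>1/2\<close> are peeled off
  alternately from those reaching farthest right and from those reaching farthest left. On either
  side of the midpoint, all groups peeled from that side, up to the last one that touches
  a given link, load this link fully, so the number of groups over the link is at most a constant
  multiple of the load plus \<open>2\<close>.\<close>

section \<open>Loads of links and groups of transmissions\<close>

text \<open>Sets of indices rather than of transmissions keep equal transmissions apart. With
  \<open>T\<close> the list lookup and \<open>I\<close> all positions this is
  \<open>link_congestion\<close>.\<close>

definition load :: "('a \<Rightarrow> transmission) \<Rightarrow> 'a set \<Rightarrow> nat \<Rightarrow> real" where
  "load T I l = (\<Sum>i | i \<in> I \<and> crosses (T i) l. height (T i))"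

text \<open>The groups whose hull, from the least source to the greatest destination, covers link
  \<open>l\<close>. No single member need cross \<open>l\<close>: the two witnesses may differ. This
  is the count that governs the number of wavelengths.\<close>

definition spanning :: "('a \<Rightarrow> transmission) \<Rightarrow> 'a set set \<Rightarrow> nat \<Rightarrow> 'a set set" where
  "spanning T P l = {G \<in> P. (\<exists>i\<in>G. src (T i) \<le> l) \<and> (\<exists>i\<in>G. l < dst (T i))}"

definition grouping :: "('a \<Rightarrow> transmission) \<Rightarrow> 'a set \<Rightarrow> 'a set set \<Rightarrow> bool" where
  "grouping T I P \<longleftrightarrow> partition_on I P \<and> (\<forall>G\<in>P. (\<Sum>i\<in>G. height (T i)) \<le> 1)"

lemma load_nonneg:
  assumes "\<And>i. i \<in> I \<Longrightarrow> 0 < height (T i)"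
  shows "0 \<le> load T I l"
  unfolding load_def using assms by (intro sum_nonneg) (auto intro: less_imp_le)

lemma load_Un:
  assumes "finite I" "finite J" "I \<inter> J = {}"
  shows "load T (I \<union> J) l = load T I l + load T J l"
proof -
  have "{i. i \<in> I \<union> J \<and> crosses (T i) l} = {i. i \<in> I \<and> crosses (T i) l} \<union> {i. i \<in> J \<and> crosses (T i) l}"
    by auto
  then show ?thesis
    unfolding load_def using assms by (simp add: sum.union_disjoint disjoint_iff)
qed

lemma load_all_crossing:
  assumes "\<And>i. i \<in> I \<Longrightarrow> crosses (T i) l"
  shows "load T I l = (\<Sum>i\<in>I. height (T i))"
  unfolding load_def using assms by (intro sum.cong) auto

lemma card_spanning_Un:
  assumes "finite P" "finite Q"
  shows "card (spanning T (P \<union> Q) l) \<le> card (spanning T P l) + card (spanning T Q l)"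
proof -
  have "spanning T (P \<union> Q) l = spanning T P l \<union> spanning T Q l"
    unfolding spanning_def by auto
  then show ?thesis by (simp add: card_Un_le)
qed

lemma card_spanning_le_card: "finite P \<Longrightarrow> card (spanning T P l) \<le> card P"
  unfolding spanning_def by (intro card_mono) auto

lemma spanning_empty_right:
  assumes "partition_on I P" "\<And>i. i \<in> I \<Longrightarrow> dst (T i) \<le> l"
  shows "spanning T P l = {}"
  using assms unfolding spanning_def partition_on_def by fastforce

lemma spanning_empty_left:
  assumes "partition_on I P" "\<And>i. i \<in> I \<Longrightarrow> l < src (T i)"
  shows "spanning T P l = {}"
  using assms unfolding spanning_def partition_on_def by fastforce

lemma grouping_finite: "finite I \<Longrightarrow> grouping T I P \<Longrightarrow> finite P"
  unfolding grouping_def by (auto intro: finite_elements)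

lemma grouping_Un:
  assumes "grouping T I P" "grouping T J Q" "I \<inter> J = {}"
  shows "grouping T (I \<union> J) (P \<union> Q)"
  using assms unfolding grouping_def partition_on_def by (auto intro: disjoint_union)

lemma grouping_empty: "grouping T {} {}"
  unfolding grouping_def by (simp add: partition_on_def)

lemma grouping_single:
  assumes "I \<noteq> {}" "(\<Sum>i\<in>I. height (T i)) \<le> 1"
  shows "grouping T I {I}"
  using assms unfolding grouping_def by (simp add: partition_on_def)

section \<open>Grouping the transmissions over one common link\<close>

text \<open>Elements with the smallest \<open>f\<close> are discarded while the total exceeds 1.
  Each discard costs at most 1/2, so the total never drops below 1/2.\<close>

lemma peel:
  fixes h :: "'a \<Rightarrow> real" and f :: "'a \<Rightarrow> 'b::linorder"
  assumes "finite I" "\<And>i. i \<in> I \<Longrightarrow> h i \<le> 1/2" "1/2 \<le> (\<Sum>i\<in>I. h i)"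
  shows "\<exists>G\<subseteq>I. 1/2 \<le> (\<Sum>i\<in>G. h i) \<and> (\<Sum>i\<in>G. h i) \<le> 1 \<and> (\<forall>i\<in>G. \<forall>j\<in>I - G. f j \<le> f i)"
  using assms
proof (induction I rule: finite_psubset_induct)
  case (psubset I)
  show ?case
  proof (cases "(\<Sum>i\<in>I. h i) \<le> 1")
    case True
    then show ?thesis using psubset.prems by (intro exI[of _ I]) auto
  next
    case False
    then have "I \<noteq> {}" by auto
    then obtain a where a: "a \<in> I" "\<And>j. j \<in> I \<Longrightarrow> f a \<le> f j"
      using psubset.hyps finite_has_minimal[of "f ` I"]
      by (metis (no_types, lifting) arg_min_least arg_min_if_finite(1))
    have "(\<Sum>i\<in>I. h i) = h a + (\<Sum>i\<in>I - {a}. h i)"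
      using a psubset.hyps by (intro sum.remove)
    then have "1/2 \<le> (\<Sum>i\<in>I - {a}. h i)"
      using False psubset.prems(1)[OF a(1)] by simp
    moreover have "I - {a} \<subset> I" using a by auto
    ultimately obtain G where "G \<subseteq> I - {a}" "1/2 \<le> (\<Sum>i\<in>G. h i)" "(\<Sum>i\<in>G. h i) \<le> 1"
      "\<forall>i\<in>G. \<forall>j\<in>I - {a} - G. f j \<le> f i"
      using psubset.IH[of "I - {a}"] psubset.prems(1) by auto
    then show ?thesis using a by (intro exI[of _ G]) auto
  qed
qed

text \<open>Each round peels \<open>G\<close>, reaching farthest right, then \<open>F\<close>,
  reaching farthest left, and recurses on the rest \<open>K\<close>. If all of \<open>G\<close> (for
  a link right of \<open>x\<close>) or all of \<open>F\<close> (left of \<open>x\<close>) crosses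
  the link, that group adds at least 1/2 to the load, and the factor 4 pays for both groups.
  Otherwise nothing in \<open>K\<close> reaches the link, and the constant 2 pays for
  \<open>G\<close> and \<open>F\<close>.\<close>

lemma grouping_over_link:
  assumes "finite I"
    and "\<And>i. i \<in> I \<Longrightarrow> crosses (T i) x"
    and "\<And>i. i \<in> I \<Longrightarrow> 0 < height (T i) \<and> height (T i) \<le> 1/2"
  shows "\<exists>P. grouping T I P \<and> (\<forall>l. card (spanning T P l) \<le> 4 * load T I l + 2)"
  using assms
proof (induction I rule: finite_psubset_induct)
  case (psubset I)
  let ?H = "\<lambda>J. \<Sum>i\<in>J. height (T i)"
  have nn: "0 \<le> load T J l" if "J \<subseteq> I" for J l
    using that psubset.prems(2) by (intro load_nonneg) auto
  show ?case
  \<comment> \<open>Too little is left to peel; the remainder becomes one group, covered by the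
    additive constant.\<close>
  proof (cases "?H I < 1/2")
    case True
    show ?thesis
    proof (cases "I = {}")
      case True
      then show ?thesis
        using grouping_empty[of T] by (intro exI[of _ "{}"]) (simp add: load_def spanning_def)
    next
      case False
      have "real (card (spanning T {I} l)) \<le> 4 * load T I l + 2" for l
        using card_spanning_le_card[of "{I}" T l] nn[of I l] by simp
      then show ?thesis using grouping_single[OF False, of T] True by (intro exI[of _ "{I}"]) auto
    qed
  next
    case False
    then obtain G where G: "G \<subseteq> I" "1/2 \<le> ?H G" "?H G \<le> 1"
      "\<forall>i\<in>G. \<forall>j\<in>I - G. dst (T j) \<le> dst (T i)"
      using peel[of I "\<lambda>i. height (T i)" "\<lambda>i. dst (T i)"] psubset.hyps psubset.prems(2)
      by (metis (no_types, lifting) not_le)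
    define J where "J = I - G"
    have "finite J" "J \<subseteq> I" and IJ: "I = G \<union> J" "G \<inter> J = {}" and "finite G"
      using psubset.hyps(1) G(1) by (auto simp: J_def intro: finite_subset)
    have "G \<noteq> {}" using G(2) by auto
    have gG: "grouping T G {G}" using grouping_single[OF \<open>G \<noteq> {}\<close> G(3)] .
    have cG: "card (spanning T {G} l) \<le> 1" for l
      using card_spanning_le_card[of "{G}" T l] by simp
    have loadI: "load T I l = load T G l + load T J l" for l
      unfolding IJ(1) using IJ(2) \<open>finite G\<close> \<open>finite J\<close> by (intro load_Un)
    show ?thesis
    proof (cases "?H J < 1/2")
      case True
      show ?thesis
      proof (cases "J = {}")
        case J: True
        have "real (card (spanning T {G} l)) \<le> 4 * load T I l + 2" for l
          using cG[of l] nn[of I l] by simp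
        then show ?thesis using gG IJ J by (intro exI[of _ "{G}"]) auto
      next
        case J: False
        have gr: "grouping T I ({G} \<union> {J})"
          unfolding IJ(1) using gG grouping_single[OF J, of T] True IJ(2) by (intro grouping_Un) auto
        have "real (card (spanning T ({G} \<union> {J}) l)) \<le> 4 * load T I l + 2" for l
          using card_spanning_Un[of "{G}" "{J}" T l] cG[of l] card_spanning_le_card[of "{J}" T l] nn[of I l]
          by simp
        then show ?thesis using gr by blast
      qed
    next
      case False
      \<comment> \<open>\<open>peel\<close> keeps the largest keys, so sources are negated, in
        \<open>int\<close> to avoid truncation.\<close>
      then obtain F where F: "F \<subseteq> J" "1/2 \<le> ?H F" "?H F \<le> 1"
        "\<forall>i\<in>F. \<forall>j\<in>J - F. - int (src (T j)) \<le> - int (src (T i))"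
        using peel[of J "\<lambda>i. height (T i)" "\<lambda>i. - int (src (T i))"] \<open>finite J\<close> \<open>J \<subseteq> I\<close> psubset.prems(2)
        by (meson in_mono leI)
      define K where "K = J - F"
      have "finite K" "K \<subseteq> I" and JK: "J = F \<union> K" "F \<inter> K = {}" and "finite F"
        using \<open>finite J\<close> \<open>J \<subseteq> I\<close> F(1) by (auto simp: K_def intro: finite_subset)
      have "F \<noteq> {}" using F(2) by auto
      have gF: "grouping T F {F}" using grouping_single[OF \<open>F \<noteq> {}\<close> F(3)] .
      have cF: "card (spanning T {F} l) \<le> 1" for l
        using card_spanning_le_card[of "{F}" T l] by simp
      have loadJ: "load T J l = load T F l + load T K l" for l
        unfolding JK(1) using JK(2) \<open>finite F\<close> \<open>finite K\<close> by (intro load_Un)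
      have "K \<subset> I" using IJ JK \<open>G \<noteq> {}\<close> by blast
      then obtain P where gP: "grouping T K P"
        and P: "\<And>l. real (card (spanning T P l)) \<le> 4 * load T K l + 2"
        using psubset.IH[of K] psubset.prems \<open>K \<subseteq> I\<close> by (meson subsetD)
      have "finite P" using grouping_finite gP \<open>finite K\<close> by blast
      have gFP: "grouping T J ({F} \<union> P)"
        unfolding JK(1) using gF gP JK(2) by (intro grouping_Un)
      have gr: "grouping T I ({G} \<union> ({F} \<union> P))"
        unfolding IJ(1) using gG gFP IJ(2) by (intro grouping_Un)
      have "real (card (spanning T ({G} \<union> ({F} \<union> P)) l)) \<le> 4 * load T I l + 2" for l
      proof -
        have c1: "card (spanning T ({G} \<union> ({F} \<union> P)) l) \<le> 1 + card (spanning T ({F} \<union> P) l)"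
          using card_spanning_Un[of "{G}" "{F} \<union> P" T l] cG[of l] \<open>finite P\<close> by simp
        have c2: "card (spanning T ({F} \<union> P) l) \<le> 1 + card (spanning T P l)"
          using card_spanning_Un[of "{F}" P T l] cF[of l] \<open>finite P\<close> by simp
        have n: "0 \<le> load T G l" "0 \<le> load T F l" "0 \<le> load T I l"
          using nn G(1) F(1) \<open>J \<subseteq> I\<close> by auto
        show ?thesis
        \<comment> \<open>Everything crosses \<open>x\<close>, so for \<open>x \<le> l\<close>
          crossing \<open>l\<close> depends on the destination alone, and for \<open>l < x\<close>
          on the source alone.\<close>
        proof (cases "x \<le> l")
          case True
          then have src: "src (T i) \<le> l" if "i \<in> I" for i
            using psubset.prems(1)[OF that] by (auto simp: crosses_def)
          show ?thesis
          proof (cases "\<forall>i\<in>G. l < dst (T i)")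
            case True
            then have "load T G l = ?H G"
              using src G(1) by (intro load_all_crossing) (auto simp: crosses_def)
            then show ?thesis using loadI[of l] loadJ[of l] P[of l] c1 c2 G(2) n by linarith
          next
            case False
            \<comment> \<open>One member of \<open>G\<close> ending by \<open>l\<close> forces all
              of \<open>J\<close> to end by \<open>l\<close>, since \<open>G\<close> took the
              greatest destinations.\<close>
            then obtain i where "i \<in> G" "dst (T i) \<le> l" by auto
            then have "dst (T j) \<le> l" if "j \<in> J" for j
              using G(4) that by (force simp: J_def)
            then have "spanning T ({F} \<union> P) l = {}"
              using gFP by (intro spanning_empty_right[of J]) (auto simp: grouping_def)
            then show ?thesis using c1 n by simp
          qed
        next
          case False
          then have dst: "l < dst (T i)" if "i \<in> I" for i
            using psubset.prems(1)[OF that] by (auto simp: crosses_def)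
          show ?thesis
          proof (cases "\<forall>i\<in>F. src (T i) \<le> l")
            case True
            then have "load T F l = ?H F"
              using dst F(1) \<open>J \<subseteq> I\<close> by (intro load_all_crossing) (auto simp: crosses_def)
            then show ?thesis using loadI[of l] loadJ[of l] P[of l] c1 c2 F(2) n by linarith
          next
            case False
            then obtain i where "i \<in> F" "l < src (T i)" by auto
            then have "l < src (T j)" if "j \<in> K" for j
              using F(4) that by (force simp: K_def)
            then have "spanning T P l = {}"
              using gP by (intro spanning_empty_left[of K]) (auto simp: grouping_def)
            then show ?thesis using c1 c2 n by simp
          qed
        qed
      qed
      then show ?thesis using gr by blast
    qed
  qed
qed

section \<open>Binary recursion over the nodes\<close>

text \<open>Halving the node range at \<open>m\<close> gives \<open>L\<close> in the left half,
  \<open>U\<close> in the right half, and \<open>M\<close> across the middle. No link is spanned by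
  groups of both \<open>L\<close> and \<open>U\<close>, so only one recursive bound counts at a
  given link, and each level adds just the 2 coming from \<open>M\<close>.\<close>

lemma grouping_small:
  assumes "finite I"
    and "\<And>i. i \<in> I \<Longrightarrow> a \<le> src (T i) \<and> src (T i) < dst (T i) \<and> dst (T i) < a + 2 ^ d"
    and "\<And>i. i \<in> I \<Longrightarrow> 0 < height (T i) \<and> height (T i) \<le> 1/2"
  shows "\<exists>P. grouping T I P \<and> (\<forall>l. card (spanning T P l) \<le> 4 * load T I l + 2 * real d)"
  using assms
proof (induction d arbitrary: a I)
  case 0
  \<comment> \<open>The range holds the single node \<open>a\<close>, leaving no room for
    \<open>src < dst\<close>.\<close>
  then have "I = {}" by fastforce
  then show ?case
    using grouping_empty[of T] by (intro exI[of _ "{}"]) (simp add: load_def spanning_def)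
next
  case (Suc d)
  define m where "m = a + 2 ^ d"
  define L where "L = {i \<in> I. dst (T i) < m}"
  define M where "M = {i \<in> I. src (T i) < m \<and> m \<le> dst (T i)}"
  define U where "U = {i \<in> I. m \<le> src (T i)}"
  have fin: "finite L" "finite M" "finite U"
    using Suc.prems(1) by (auto simp: L_def M_def U_def)
  have "m > 0" by (simp add: m_def)
  have I: "I = M \<union> (L \<union> U)"
    by (auto simp: L_def M_def U_def)
  have disj: "M \<inter> (L \<union> U) = {}" "L \<inter> U = {}"
    using Suc.prems(2) by (force simp: L_def M_def U_def)+
  have "\<exists>P. grouping T L P \<and> (\<forall>l. card (spanning T P l) \<le> 4 * load T L l + 2 * real d)"
    by (rule Suc.IH[of L a]) (use fin Suc.prems(2,3) in \<open>auto simp: L_def m_def\<close>)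
  then obtain PL where gL: "grouping T L PL"
    and PL: "\<And>l. card (spanning T PL l) \<le> 4 * load T L l + 2 * real d" by auto
  have "\<exists>P. grouping T U P \<and> (\<forall>l. card (spanning T P l) \<le> 4 * load T U l + 2 * real d)"
    by (rule Suc.IH[of U m]) (use fin Suc.prems(2,3) in \<open>force simp: U_def m_def\<close>)+
  then obtain PU where gU: "grouping T U PU"
    and PU: "\<And>l. card (spanning T PU l) \<le> 4 * load T U l + 2 * real d" by auto
  have "\<exists>P. grouping T M P \<and> (\<forall>l. card (spanning T P l) \<le> 4 * load T M l + 2)"
    \<comment> \<open>Link \<open>m - 1\<close> joins the last node of the left half to the first
      node of the right half.\<close>
    by (rule grouping_over_link[of M T "m - 1"])
      (use fin Suc.prems(3) \<open>m > 0\<close> in \<open>auto simp: M_def crosses_def\<close>)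
  then obtain PM where gM: "grouping T M PM"
    and PM: "\<And>l. card (spanning T PM l) \<le> 4 * load T M l + 2" by auto
  have finP: "finite PL" "finite PM" "finite PU"
    using grouping_finite gL gM gU fin by blast+
  have gr: "grouping T I (PM \<union> (PL \<union> PU))"
    unfolding I using gL gM gU disj by (intro grouping_Un)
  have "real (card (spanning T (PM \<union> (PL \<union> PU)) l)) \<le> 4 * load T I l + 2 * real (Suc d)" for l
  proof -
    have c: "card (spanning T (PM \<union> (PL \<union> PU)) l)
        \<le> card (spanning T PM l) + (card (spanning T PL l) + card (spanning T PU l))"
      using card_spanning_Un[of PM "PL \<union> PU" T l] card_spanning_Un[of PL PU T l] finP by simp
    have "load T I l = load T M l + load T (L \<union> U) l"
      unfolding I using fin disj by (intro load_Un) auto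
    moreover have "load T (L \<union> U) l = load T L l + load T U l"
      using fin disj by (intro load_Un)
    ultimately have ld: "load T I l = load T M l + (load T L l + load T U l)" by simp
    have nn: "0 \<le> load T L l" "0 \<le> load T U l"
      using Suc.prems(3) by (auto intro!: load_nonneg simp: L_def U_def)
    show ?thesis
    proof (cases "l < m")
      case True
      then have "spanning T PU l = {}"
        using gU by (intro spanning_empty_left[of U]) (auto simp: grouping_def U_def)
      then show ?thesis using c ld nn PM[of l] PL[of l] by simp
    next
      case False
      then have "spanning T PL l = {}"
        using gL by (intro spanning_empty_right[of L]) (auto simp: grouping_def L_def)
      then show ?thesis using c ld nn PM[of l] PU[of l] by simp
    qed
  qed
  then show ?case using gr by blast
qed

text \<open>A singleton spans exactly the links that its transmission crosses, and loads each of
  them by at least 1/2.\<close>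

lemma grouping_large:
  assumes "finite I"
    and "\<And>i. i \<in> I \<Longrightarrow> 1/2 \<le> height (T i) \<and> height (T i) \<le> 1"
  shows "\<exists>P. grouping T I P \<and> (\<forall>l. card (spanning T P l) \<le> 2 * load T I l)"
proof (intro exI conjI allI)
  let ?P = "(\<lambda>i. {i}) ` I"
  show "grouping T I ?P"
    using assms(2) by (auto simp: grouping_def partition_on_def disjoint_def)
  fix l
  let ?C = "{i. i \<in> I \<and> crosses (T i) l}"
  have "spanning T ?P l = (\<lambda>i. {i}) ` ?C"
    by (auto simp: spanning_def crosses_def)
  then have "real (card (spanning T ?P l)) = card ?C"
    by (simp add: card_image)
  also have "\<dots> = 2 * (\<Sum>i\<in>?C. 1/2)" by simp
  also have "\<dots> \<le> 2 * load T I l"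
    unfolding load_def using assms(2) by (intro mult_left_mono sum_mono) auto
  finally show "real (card (spanning T ?P l)) \<le> 2 * load T I l" .
qed

text \<open>Heights are separated at 1/2. The two bounds add up because loads do, the factor 2 for
  high transmissions being absorbed by 4.\<close>

lemma grouping_exists:
  assumes "finite I"
    and "\<And>i. i \<in> I \<Longrightarrow> src (T i) < dst (T i) \<and> dst (T i) < 2 ^ d"
    and "\<And>i. i \<in> I \<Longrightarrow> 0 < height (T i) \<and> height (T i) \<le> 1"
  shows "\<exists>P. grouping T I P \<and> (\<forall>l. card (spanning T P l) \<le> 4 * load T I l + 2 * real d)"
proof -
  define S where "S = {i \<in> I. height (T i) \<le> 1/2}"
  define B where "B = {i \<in> I. 1/2 < height (T i)}"
  have fin: "finite S" "finite B" and I: "I = S \<union> B" "S \<inter> B = {}"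
    using assms(1) by (auto simp: S_def B_def)
  obtain P where gP: "grouping T S P"
    and P: "\<And>l. card (spanning T P l) \<le> 4 * load T S l + 2 * real d"
    using grouping_small[of S 0 T d] fin assms by (auto simp: S_def)
  obtain Q where gQ: "grouping T B Q" and Q: "\<And>l. card (spanning T Q l) \<le> 2 * load T B l"
    using grouping_large[of B T] fin assms(3) by (force simp: B_def)
  have "card (spanning T (P \<union> Q) l) \<le> 4 * load T I l + 2 * real d" for l
  proof -
    have "0 \<le> load T B l" using assms(3) by (auto intro!: load_nonneg simp: B_def)
    moreover have "load T I l = load T S l + load T B l"
      unfolding I(1) using fin I(2) by (intro load_Un)
    ultimately show ?thesis
      using P[of l] Q[of l] card_spanning_Un[of P Q T l] grouping_finite gP gQ fin
      by fastforce
  qed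
  moreover have "grouping T I (P \<union> Q)"
    unfolding I(1) using gP gQ I(2) by (intro grouping_Un)
  ultimately show ?thesis by blast
qed

section \<open>Colouring intervals and building the schedule\<close>

text \<open>Greedy colouring by left end: the interval \<open>X\<close> starting last is coloured
  after all others. Those that overlap it all contain \<open>lo X\<close>, so with \<open>X\<close>
  itself they number at most \<open>w\<close>, and some colour is free.\<close>

lemma interval_colouring:
  fixes lo hi :: "'a \<Rightarrow> nat"
  assumes "finite P" "\<And>G. G \<in> P \<Longrightarrow> lo G < hi G"
    and "\<And>l. card {G \<in> P. lo G \<le> l \<and> l < hi G} \<le> w"
  shows "\<exists>col. (\<forall>G\<in>P. col G < w) \<and>
    (\<forall>G\<in>P. \<forall>H\<in>P. G \<noteq> H \<longrightarrow> col G = col H \<longrightarrow> hi G \<le> lo H \<or> hi H \<le> lo G)"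
  using assms
proof (induction P rule: finite_psubset_induct)
  case (psubset P)
  show ?case
  proof (cases "P = {}")
    case False
    then obtain X where X: "X \<in> P" "\<And>G. G \<in> P \<Longrightarrow> lo G \<le> lo X"
    proof -
      have "Max (lo ` P) \<in> lo ` P" using False psubset.hyps by (intro Max_in) auto
      then obtain X where "X \<in> P" "lo X = Max (lo ` P)" by auto
      then show ?thesis using psubset.hyps by (intro that[of X]) auto
    qed
    define P' where "P' = P - {X}"
    have P': "P' \<subset> P" "finite P'" using X psubset.hyps by (auto simp: P'_def)
    have "card {G \<in> P'. lo G \<le> l \<and> l < hi G} \<le> w" for l
      by (rule order_trans[OF card_mono psubset.prems(2)[of l]])
        (use psubset.hyps in \<open>auto simp: P'_def\<close>)
    then obtain col where col: "\<forall>G\<in>P'. col G < w"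
      "\<forall>G\<in>P'. \<forall>H\<in>P'. G \<noteq> H \<longrightarrow> col G = col H \<longrightarrow> hi G \<le> lo H \<or> hi H \<le> lo G"
      using psubset.IH[of P'] P' psubset.prems(1) by (auto simp: P'_def)
    let ?N = "{G \<in> P'. lo G \<le> lo X \<and> lo X < hi G}"
    have "{G \<in> P. lo G \<le> lo X \<and> lo X < hi G} = insert X ?N"
      using X psubset.prems(1) by (auto simp: P'_def)
    moreover have "X \<notin> ?N" by (simp add: P'_def)
    ultimately have "card ?N < w"
      using psubset.prems(2)[of "lo X"] P' by simp
    then have "card (col ` ?N) < card {..<w}"
      using card_image_le[of ?N col] P' by simp
    then have "\<not> {..<w} \<subseteq> col ` ?N"
      using card_mono[of "col ` ?N" "{..<w}"] P' by fastforce
    then obtain k where k: "k < w" "k \<notin> col ` ?N" by auto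
    \<comment> \<open>\<open>G\<close> starts no later than \<open>X\<close>; having the free colour
      \<open>k\<close>, it lies outside \<open>?N\<close> and so ends by
      \<open>lo X\<close>.\<close>
    have sep: "hi G \<le> lo X" if "G \<in> P'" "col G = k" for G
      using k(2) that X(2)[of G] by (force simp: P'_def)
    show ?thesis
      using col k(1) sep X(1)
      by (intro exI[of _ "col(X := k)"]) (auto simp: P'_def)
  qed auto
qed

text \<open>Each group gets its hull \<open>[lo G, hi G]\<close> as a light-trail, on the wavelength
  given by its colour. Shutters are OFF at the hull ends and at the two end nodes; hulls of one
  colour may share an end node but no link.\<close>

lemma schedulable_of_grouping:
  fixes R :: "transmission list"
  assumes n: "n \<ge> 2" and valid: "\<And>t. t \<in> set R \<Longrightarrow> valid_transmission n t"
    and gr: "grouping ((!) R) {..<length R} P"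
    and w: "\<And>l. card (spanning ((!) R) P l) \<le> w"
  shows "schedulable n w R"
proof -
  let ?T = "(!) R"
  define lo where "lo G = Min ((\<lambda>i. src (?T i)) ` G)" for G
  define hi where "hi G = Max ((\<lambda>i. dst (?T i)) ` G)" for G
  have part: "partition_on {..<length R} P" and le1: "\<And>G. G \<in> P \<Longrightarrow> (\<Sum>i\<in>G. height (?T i)) \<le> 1"
    using gr by (auto simp: grouping_def)
  have "finite P" using gr grouping_finite by blast
  have G: "finite G" "G \<noteq> {}" "G \<subseteq> {..<length R}" if "G \<in> P" for G
    using part that finite_subset[of G "{..<length R}"] by (auto simp: partition_on_def)
  have vT: "src (?T i) < dst (?T i)" "dst (?T i) \<le> n - 1" if "i < length R" for i
    using valid[of "?T i"] that by (auto simp: valid_transmission_def)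
  have lo: "lo G \<le> src (?T i)" and hi: "dst (?T i) \<le> hi G" if "G \<in> P" "i \<in> G" for G i
    using G[OF that(1)] that(2) by (auto simp: lo_def hi_def)
  have lohi: "lo G < hi G" if "G \<in> P" for G
  proof -
    obtain i where i: "i \<in> G" "i < length R" using G(2,3)[OF \<open>G \<in> P\<close>] by blast
    then show ?thesis using lo[OF that i(1)] hi[OF that i(1)] vT(1)[of i] by linarith
  qed
  have hin: "hi G \<le> n - 1" if "G \<in> P" for G
    using G[OF that] vT(2) by (auto simp: hi_def)
  \<comment> \<open>Groups are finite and nonempty, so the extrema are attained; this turns the
    bound on \<open>spanning\<close> into the hypothesis of the colouring.\<close>
  have span: "{G \<in> P. lo G \<le> l \<and> l < hi G} = spanning ?T P l" for l
    using G by (auto simp: spanning_def lo_def hi_def Min_le_iff Max_gr_iff)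
  obtain col where col: "\<And>G. G \<in> P \<Longrightarrow> col G < w"
    and sep: "\<And>G H. G \<in> P \<Longrightarrow> H \<in> P \<Longrightarrow> G \<noteq> H \<Longrightarrow> col G = col H \<Longrightarrow> hi G \<le> lo H \<or> hi H \<le> lo G"
  proof -
    obtain col where "\<forall>G\<in>P. col G < w"
      "\<forall>G\<in>P. \<forall>H\<in>P. G \<noteq> H \<longrightarrow> col G = col H \<longrightarrow> hi G \<le> lo H \<or> hi H \<le> lo G"
      using interval_colouring[of P lo hi w] \<open>finite P\<close> lohi w unfolding span by auto
    then show ?thesis by (intro that[of col]) blast+
  qed
  define off where "off k = {0, n - 1} \<union> (\<Union>G\<in>{G \<in> P. col G = k}. {lo G, hi G})" for k
  define trail where "trail G = (col G, lo G, hi G)" for G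
  have "\<exists>G\<in>P. i \<in> G" if "i < length R" for i
    using part that by (auto simp: partition_on_def)
  then obtain g where g: "\<And>i. i < length R \<Longrightarrow> g i \<in> P \<and> i \<in> g i" by metis
  define A where "A i = trail (g i)" for i
  have g_eq: "g i = G" if "G \<in> P" "i \<in> G" for i G
  proof -
    have "i < length R" using G(3)[OF that(1)] that(2) by blast
    then show ?thesis
      using g[of i] that disjointD[OF partition_onD2[OF part], of "g i" G] by blast
  qed
  \<comment> \<open>Distinct groups with the same trail would be overlapping hulls of one colour.
    Hence a trail carries one group only and inherits its bound 1.\<close>
  have trail_inj: "G = H" if "G \<in> P" "H \<in> P" "trail G = trail H" for G H
    using sep[of G H] lohi[of G] that by (auto simp: trail_def)
  have trail: "trail G \<in> light_trails w off" if "G \<in> P" for G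
  proof -
    have "off (col G) \<inter> {lo G<..<hi G} = {}"
    proof -
      \<comment> \<open>An OFF node strictly inside the hull would be an end of another hull
        \<open>H\<close> of the same colour, and as \<open>lo H < hi H\<close> the two would
        overlap.\<close>
      have False if "y \<in> off (col G)" "lo G < y" "y < hi G" for y
      proof -
        have "y \<noteq> 0" "y \<noteq> n - 1" using that hin[OF \<open>G \<in> P\<close>] by auto
        then obtain H where H: "H \<in> P" "col H = col G" "y = lo H \<or> y = hi H"
          using \<open>y \<in> off (col G)\<close> by (auto simp: off_def)
        then have "H \<noteq> G" using that by auto
        then show False using sep[OF \<open>G \<in> P\<close> H(1)] H(2,3) that lohi[OF H(1)] by auto
      qed
      then show ?thesis by auto
    qed
    then show ?thesis
      using that col[OF that] lohi[OF that] by (auto simp: light_trails_def trail_def off_def)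
  qed
  have "valid_shutters n (off k)" for k
    using hin lohi by (fastforce simp: valid_shutters_def off_def)
  moreover have "A i \<in> light_trails w off \<and> fits (?T i) (A i)" if "i < length R" for i
    using g[OF that] trail lo hi by (auto simp: A_def fits_def trail_def)
  moreover have "(\<Sum>i | i < length R \<and> A i = L. height (?T i)) \<le> 1" for L
  proof (cases "\<exists>G\<in>P. trail G = L")
    case True
    then obtain G where "G \<in> P" "trail G = L" by auto
    then have "{i. i < length R \<and> A i = L} = G"
      using g trail_inj g_eq[of G] G(3)[of G] by (fastforce simp: A_def)
    then show ?thesis using le1 \<open>G \<in> P\<close> by simp
  next
    \<comment> \<open>Light-trails that fill the gaps between hulls stay empty.\<close>
    case False
    then have "{i. i < length R \<and> A i = L} = {}" using g by (auto simp: A_def)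
    then show ?thesis by (simp only: sum.empty zero_le_one)
  qed
  ultimately have "is_schedule n w R off A" by (auto simp: is_schedule_def)
  then show ?thesis by (auto simp: schedulable_def)
qed

section \<open>Counting wavelengths\<close>

lemma load_eq_link_congestion: "load ((!) R) {..<length R} l = link_congestion R l"
proof -
  have "link_congestion R l = (\<Sum>t\<leftarrow>R. if crosses t l then height t else 0)"
    by (simp add: link_congestion_def sum_list_map_filter')
  also have "\<dots> = (\<Sum>i<length R. if crosses (R ! i) l then height (R ! i) else 0)"
    by (simp add: sum_list_sum_nth atLeast0LessThan)
  also have "\<dots> = load ((!) R) {..<length R} l"
    by (simp add: load_def sum.inter_filter[symmetric])
  finally show ?thesis ..
qed

text \<open>Every transmission is taken as its own single part.\<close>

lemma splittably_schedulable_of_schedulable: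
  assumes "\<And>t. t \<in> set R \<Longrightarrow> 0 < height t" "schedulable n w R"
  shows "splittably_schedulable n w R"
proof -
  have "list_all2 splits_into R (map (\<lambda>t. [t]) R)"
    using assms(1) by (auto simp: list_all2_conv_all_nth splits_into_def)
  moreover have "concat (map (\<lambda>t. [t]) R) = R" by (induction R) auto
  ultimately show ?thesis
    unfolding splittably_schedulable_def using assms(2) by metis
qed

text \<open>The recursion has depth \<open>d\<close>, the rounded-up logarithm of \<open>n\<close>,
  and yields \<open>4 * c + 2 * d\<close> wavelengths; \<open>d\<close> is at most twice the
  logarithm, which gives the constant 4.\<close>

lemma schedulable_few_wavelengths:
  assumes n: "n \<ge> 2" and valid: "\<And>t. t \<in> set R \<Longrightarrow> valid_transmission n t"
  shows "\<exists>w. real w \<le> 4 * (congestion n R + log 2 (real n)) \<and> schedulable n w R"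
proof -
  let ?T = "(!) R" and ?I = "{..<length R}"
  define c where "c = congestion n R"
  define d where "d = nat \<lceil>log 2 (real n)\<rceil>"
  have log1: "1 \<le> log 2 (real n)" using n by simp
  have "log 2 (real n) \<le> d" unfolding d_def by linarith
  then have "real n \<le> 2 powr d" using n by (simp add: log_le_iff)
  then have nd: "n \<le> 2 ^ d" by (simp add: powr_realpow)
  \<comment> \<open>Rounding up adds less than 1, and the logarithm is at least 1 because
    \<open>n \<ge> 2\<close>.\<close>
  have dn: "real d \<le> 2 * log 2 (real n)" using log1 unfolding d_def by linarith
  have T: "src (?T i) < dst (?T i) \<and> dst (?T i) \<le> n - 1" "0 < height (?T i) \<and> height (?T i) \<le> 1"
    if "i \<in> ?I" for i
    using valid[of "?T i"] that by (auto simp: valid_transmission_def)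
  have "\<exists>P. grouping ?T ?I P \<and> (\<forall>l. card (spanning ?T P l) \<le> 4 * load ?T ?I l + 2 * real d)"
    by (rule grouping_exists) (use T n nd in force)+
  then obtain P where gr: "grouping ?T ?I P"
    and P: "\<And>l. card (spanning ?T P l) \<le> 4 * load ?T ?I l + 2 * real d" by auto
  have load_c: "load ?T ?I l \<le> c" if "l \<le> n - 2" for l
    unfolding c_def congestion_def load_eq_link_congestion using that by (intro Max_ge) auto
  have "0 \<le> load ?T ?I 0" using T(2) by (intro load_nonneg) auto
  then have c0: "0 \<le> c" using load_c[of 0] by simp
  define w where "w = nat \<lfloor>4 * c + 2 * real d\<rfloor>"
  have card_w: "card (spanning ?T P l) \<le> w" for l
  proof (cases "l \<le> n - 2")
    case True
    then have "real (card (spanning ?T P l)) \<le> 4 * c + 2 * real d"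
      using P[of l] load_c[of l] by simp
    then show ?thesis unfolding w_def by linarith
  next
    \<comment> \<open>\<open>congestion\<close> says nothing of such \<open>l\<close>, but every
      destination is at most \<open>n - 1\<close>, hence at most \<open>l\<close>.\<close>
    case False
    then have "spanning ?T P l = {}"
      using gr T(1) by (intro spanning_empty_right[of ?I]) (fastforce simp: grouping_def)+
    then show ?thesis by simp
  qed
  have "schedulable n w R" using schedulable_of_grouping[OF n valid gr card_w] .
  moreover have "real w \<le> 4 * (c + log 2 (real n))"
  proof -
    have "real w \<le> 4 * c + 2 * real d"
      unfolding w_def using c0 by (intro of_nat_floor) auto
    then show ?thesis using dn by argo
  qed
  ultimately show ?thesis unfolding c_def by blast
qed

theorem theorem4:
  shows "\<exists>K::real. \<forall>n\<ge>2. \<forall>R. (\<forall>t\<in>set R. valid_transmission n t) \<longrightarrow>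
    (\<exists>w. real w \<le> K * (congestion n R + log 2 (real n)) \<and> schedulable n w R) \<and>
    (\<exists>w. real w \<le> K * (congestion n R + log 2 (real n)) \<and> splittably_schedulable n w R)"
proof (intro exI[of _ 4] allI impI)
  fix n :: nat and R
  assume "2 \<le> n" and R: "\<forall>t\<in>set R. valid_transmission n t"
  then obtain w where w: "real w \<le> 4 * (congestion n R + log 2 (real n))" "schedulable n w R"
    using schedulable_few_wavelengths by blast
  moreover have "splittably_schedulable n w R"
    using w(2) R by (intro splittably_schedulable_of_schedulable) (auto simp: valid_transmission_def)
  ultimately show "(\<exists>w. real w \<le> 4 * (congestion n R + log 2 (real n)) \<and> schedulable n w R) \<and>
      (\<exists>w. real w \<le> 4 * (congestion n R + log 2 (real n)) \<and> splittably_schedulable n w R)"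
    by blast
qed

end
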